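(* A biased graph $\Omega$ is $\Gamma$-gainable for all groups $\Gamma$ that have an element of order at least three (possibly infinite) if and only if $\Omega$ is $\mathbb{Z}_3$-gainable and $\mathbb{Z}_4$-gainable.
   Context: Graphs are finite and may have loops and parallel edges. A cycle of a graph is a nonempty connected subgraph in which every vertex has degree $2$ (so a loop is a 1-edge cycle and two parallel edges form a 2-edge cycle). A theta subgraph consists of two distinct vertices and three internally disjoint paths joining them. A biased graph is a pair $\Omega=(G,\mathcal{B})$ where $G$ is a graph and $\mathcal{B}$ is a set of cycles of $G$ (called balanced) such that no theta subgraph of $G$ contains exactly two cycles in $\mathcal{B}$. An arc of $G$ is a triple $(e,u,v)$, where $e$ is an edge, $u,v$ are vertices incident with $e$, and $u\neq v$ if $e$ is not a loop. For a group $\Gamma$, a $\Gamma$-gaining of $G$ is a function $\gamma$ from the arcs of $G$ to $\Gamma$ with $\gamma(e,v,u)=\gamma(e,u,v)^{-1}$ for every non-loop edge $e$. The gain of a walk $u_0,e_0,u_1,\ldots,e_{n-1},u_n$ is $\gamma(e_0,u_0,u_1)\cdots\gamma(e_{n-1},u_{n-1},u_n)$. A simple closed walk of a cycle is a closed walk traversing the cycle exactly once; whether its gain is the identity does not depend on starting vertex or direction. Let $\mathcal{B}_\gamma$ be the set of cycles whose simple closed walks have identity gain. $(G,\mathcal{B})$ is $\Gamma$-gainable if there is a $\Gamma$-gaining $\gamma$ of $G$ with $\mathcal{B}=\mathcal{B}_\gamma$. $\mathbb{Z}_n$ is the cyclic group of order $n$. *)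

theory Defs
  imports "HOL-Algebra.Elementary_Groups" "HOL-Algebra.Multiplicative_Group"
begin

text \<open>
  Finite undirected multigraphs: a loop at \<open>v\<close> has \<open>ends G e = {v}\<close>, any other edge has exactly two
  end-vertices.
\<close>

record ('v, 'e) multigraph =
  verts :: "'v set"
  edges :: "'e set"
  ends :: "'e \<Rightarrow> 'v set"

definition finite_graph :: "('v, 'e) multigraph \<Rightarrow> bool" where
  "finite_graph G \<longleftrightarrow> finite (verts G) \<and> finite (edges G) \<and>
     (\<forall>e\<in>edges G. ends G e \<subseteq> verts G \<and> card (ends G e) \<in> {1, 2})"

text \<open>
  The incidence function of a subgraph is required to agree with that of the ambient graph
  everywhere, so that two subgraphs of \<open>G\<close> are equal as records iff they have the same vertices
  and edges.
\<close>

definition subgraph :: "('v, 'e) multigraph \<Rightarrow> ('v, 'e) multigraph \<Rightarrow> bool" where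
  "subgraph H G \<longleftrightarrow> verts H \<subseteq> verts G \<and> edges H \<subseteq> edges G \<and> ends H = ends G \<and>
     (\<forall>e\<in>edges H. ends H e \<subseteq> verts H)"

text \<open>
  The condition \<open>ends G e = {u, v}\<close> forces \<open>u \<noteq> v\<close> exactly when \<open>e\<close> is not a loop; a loop gives a
  single arc.
\<close>

definition arcs :: "('v, 'e) multigraph \<Rightarrow> ('e \<times> 'v \<times> 'v) set" where
  "arcs G = {(e, u, v). e \<in> edges G \<and> ends G e = {u, v}}"

text \<open>
  The walk \<open>u\<^sub>0, e\<^sub>0, u\<^sub>1, \<dots>, u\<^sub>n\<close> is represented by its initial vertex \<open>u\<^sub>0\<close> together with the
  list of arcs \<open>(e\<^sub>i, u\<^sub>i, u\<^sub>i\<^sub>+\<^sub>1)\<close>.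
\<close>

fun walk :: "('v, 'e) multigraph \<Rightarrow> 'v \<Rightarrow> ('e \<times> 'v \<times> 'v) list \<Rightarrow> 'v \<Rightarrow> bool" where
  "walk G u [] w \<longleftrightarrow> u \<in> verts G \<and> u = w"
| "walk G u ((e, x, y) # as) w \<longleftrightarrow> x = u \<and> (e, x, y) \<in> arcs G \<and> walk G y as w"

definition walk_edges :: "('e \<times> 'v \<times> 'v) list \<Rightarrow> 'e list" where
  "walk_edges as = map fst as"

definition walk_verts :: "'v \<Rightarrow> ('e \<times> 'v \<times> 'v) list \<Rightarrow> 'v list" where
  "walk_verts u as = u # map (\<lambda>(e, x, y). y) as"

definition is_path :: "('v, 'e) multigraph \<Rightarrow> 'v \<Rightarrow> ('e \<times> 'v \<times> 'v) list \<Rightarrow> 'v \<Rightarrow> bool" where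
  "is_path G u as w \<longleftrightarrow> walk G u as w \<and> distinct (walk_verts u as)"

definition connected_graph :: "('v, 'e) multigraph \<Rightarrow> bool" where
  "connected_graph G \<longleftrightarrow> (\<forall>u\<in>verts G. \<forall>w\<in>verts G. \<exists>as. walk G u as w)"

text \<open>Loops count twice towards the degree.\<close>

definition degree :: "('v, 'e) multigraph \<Rightarrow> 'v \<Rightarrow> nat" where
  "degree G v = card {e \<in> edges G. v \<in> ends G e} + card {e \<in> edges G. ends G e = {v}}"

definition is_cycle :: "('v, 'e) multigraph \<Rightarrow> ('v, 'e) multigraph \<Rightarrow> bool" where
  "is_cycle G C \<longleftrightarrow> subgraph C G \<and> verts C \<noteq> {} \<and> connected_graph C \<and>
     (\<forall>v\<in>verts C. degree C v = 2)"

text \<open>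
  Edge-disjointness only excludes that the same one-edge path is used twice; for paths with at
  least one internal vertex it follows from internal disjointness.
\<close>

definition internally_disjoint ::
  "'v \<Rightarrow> 'v \<Rightarrow> ('e \<times> 'v \<times> 'v) list \<Rightarrow> ('e \<times> 'v \<times> 'v) list \<Rightarrow> bool" where
  "internally_disjoint u w p q \<longleftrightarrow>
     set (walk_verts u p) \<inter> set (walk_verts u q) = {u, w} \<and>
     set (walk_edges p) \<inter> set (walk_edges q) = {}"

definition is_theta :: "('v, 'e) multigraph \<Rightarrow> ('v, 'e) multigraph \<Rightarrow> bool" where
  "is_theta G T \<longleftrightarrow> subgraph T G \<and>
     (\<exists>u w p q r. u \<noteq> w \<and> is_path T u p w \<and> is_path T u q w \<and> is_path T u r w \<and>
        internally_disjoint u w p q \<and> internally_disjoint u w p r \<and> internally_disjoint u w q r \<and>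
        verts T = set (walk_verts u p) \<union> set (walk_verts u q) \<union> set (walk_verts u r) \<and>
        edges T = set (walk_edges p) \<union> set (walk_edges q) \<union> set (walk_edges r))"

type_synonym ('v, 'e) bgraph = "('v, 'e) multigraph \<times> ('v, 'e) multigraph set"

definition biased_graph :: "('v, 'e) bgraph \<Rightarrow> bool" where
  "biased_graph \<Omega> \<longleftrightarrow> (case \<Omega> of (G, \<B>) \<Rightarrow>
     finite_graph G \<and> (\<forall>C\<in>\<B>. is_cycle G C) \<and>
     (\<forall>T. is_theta G T \<longrightarrow> card {C \<in> \<B>. subgraph C T} \<noteq> 2))"

definition gaining ::
  "'g monoid \<Rightarrow> ('v, 'e) multigraph \<Rightarrow> ('e \<times> 'v \<times> 'v \<Rightarrow> 'g) \<Rightarrow> bool" where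
  "gaining \<Gamma> G \<gamma> \<longleftrightarrow> \<gamma> \<in> arcs G \<rightarrow> carrier \<Gamma> \<and>
     (\<forall>e u v. (e, u, v) \<in> arcs G \<and> u \<noteq> v \<longrightarrow> \<gamma> (e, v, u) = inv\<^bsub>\<Gamma>\<^esub> (\<gamma> (e, u, v)))"

fun walk_gain :: "'g monoid \<Rightarrow> ('e \<times> 'v \<times> 'v \<Rightarrow> 'g) \<Rightarrow> ('e \<times> 'v \<times> 'v) list \<Rightarrow> 'g" where
  "walk_gain \<Gamma> \<gamma> [] = \<one>\<^bsub>\<Gamma>\<^esub>"
| "walk_gain \<Gamma> \<gamma> (a # as) = \<gamma> a \<otimes>\<^bsub>\<Gamma>\<^esub> walk_gain \<Gamma> \<gamma> as"

definition simple_closed_walk ::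
  "('v, 'e) multigraph \<Rightarrow> 'v \<Rightarrow> ('e \<times> 'v \<times> 'v) list \<Rightarrow> bool" where
  "simple_closed_walk C u as \<longleftrightarrow>
     walk C u as u \<and> distinct (walk_edges as) \<and> set (walk_edges as) = edges C"

definition balanced_cycles ::
  "'g monoid \<Rightarrow> ('v, 'e) multigraph \<Rightarrow> ('e \<times> 'v \<times> 'v \<Rightarrow> 'g) \<Rightarrow> ('v, 'e) multigraph set" where
  "balanced_cycles \<Gamma> G \<gamma> = {C. is_cycle G C \<and>
     (\<forall>u as. simple_closed_walk C u as \<longrightarrow> walk_gain \<Gamma> \<gamma> as = \<one>\<^bsub>\<Gamma>\<^esub>)}"

definition gainable :: "'g monoid \<Rightarrow> ('v, 'e) bgraph \<Rightarrow> bool" where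
  "gainable \<Gamma> \<Omega> \<longleftrightarrow> (case \<Omega> of (G, \<B>) \<Rightarrow> \<exists>\<gamma>. gaining \<Gamma> G \<gamma> \<and> \<B> = balanced_cycles \<Gamma> G \<gamma>)"

text \<open>In \<open>HOL-Algebra\<close>, \<open>ord x = 0\<close> means that \<open>x\<close> has infinite order.\<close>

definition has_element_of_order_ge_3 :: "'g monoid \<Rightarrow> bool" where
  "has_element_of_order_ge_3 \<Gamma> \<longleftrightarrow>
     (\<exists>x\<in>carrier \<Gamma>. group.ord \<Gamma> x = 0 \<or> group.ord \<Gamma> x \<ge> 3)"

text \<open>
  HOL cannot quantify over all types inside a formula, so a statement about all groups is a schema
  in the type \<open>'g\<close> of group elements. Taken alone, the groups over a fixed \<open>'g\<close> need not include
  (copies of) particular cyclic groups, for instance if \<open>'g\<close> is \<open>unit\<close>. The predicate below hence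
  always covers the groups with elements in the type of integers, where the library's cyclic groups
  live, in addition to those with elements in the arbitrary type \<open>'g\<close>.
\<close>

definition gainable_over_all_groups :: "'g itself \<Rightarrow> ('v, 'e) bgraph \<Rightarrow> bool" where
  "gainable_over_all_groups _ \<Omega> \<longleftrightarrow>
     (\<forall>\<Gamma> :: 'g monoid. group \<Gamma> \<and> has_element_of_order_ge_3 \<Gamma> \<longrightarrow> gainable \<Gamma> \<Omega>) \<and>
     (\<forall>\<Gamma> :: int monoid. group \<Gamma> \<and> has_element_of_order_ge_3 \<Gamma> \<longrightarrow> gainable \<Gamma> \<Omega>)"

end

(*
  Let a and b be a Z3- and a Z4-gaining of G with the same balanced cycles. To a simple closed walk
  with gains i and j assign the integer f that is 0 if j = 0, and otherwise is congruent to i modulo 3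
  and has absolute value 1 if j is odd and 2 if j = 2. Along a theta graph without balanced cycles
  two of the three Z4-gains are odd and the third is 2, while all three Z3-gains are nonzero, and this
  forces f to be additive over the integers. A function on oriented cycles that is additive on theta
  graphs is the gain function of an integer gaining: add the edges one at a time, and connect any two
  paths between the ends of the new edge by rerouting one along the other, one theta at a time.
  If x has order at least 3, then x^k = 1 with |k| <= 2 only for k = 0, so raising x to this integer
  gaining gives a gaining with the same balanced cycles as b.
*)

theory Submission
  imports Defs "HOL-Library.Multiset"
begin

section \<open>Walks and circuits\<close>

abbreviation src :: "'e \<times> 'v \<times> 'v \<Rightarrow> 'v" where "src a \<equiv> fst (snd a)"
abbreviation tgt :: "'e \<times> 'v \<times> 'v \<Rightarrow> 'v" where "tgt a \<equiv> snd (snd a)"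

definition rev_walk :: "('e \<times> 'v \<times> 'v) list \<Rightarrow> ('e \<times> 'v \<times> 'v) list" where
  "rev_walk as = rev (map (\<lambda>(e, x, y). (e, y, x)) as)"

lemma rev_walk_simps [simp]:
  "rev_walk [] = []"
  "rev_walk ((e, x, y) # as) = rev_walk as @ [(e, y, x)]"
  "rev_walk (as @ bs) = rev_walk bs @ rev_walk as"
  by (auto simp: rev_walk_def)

lemma rev_walk_eq_Nil_iff [simp]: "rev_walk as = [] \<longleftrightarrow> as = []"
  by (simp add: rev_walk_def)

lemma map_fst_rev_walk [simp]: "map fst (rev_walk as) = rev (map fst as)"
  by (induction as) auto

lemma map_tgt_rev_walk [simp]: "map tgt (rev_walk as) = rev (map src as)"
  by (induction as) auto

lemma set_rev_walk: "set (rev_walk as) = (\<lambda>(e, x, y). (e, y, x)) ` set as"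
  by (simp add: rev_walk_def)

lemma walk_verts_eq: "walk_verts u as = u # map tgt as"
  by (simp add: walk_verts_def case_prod_beta)

lemma walk_Cons_iff [simp]:
  "walk G u (a # as) w \<longleftrightarrow> src a = u \<and> a \<in> arcs G \<and> walk G (tgt a) as w"
  by (cases a) auto

lemma arcs_rev: "(e, x, y) \<in> arcs G \<Longrightarrow> (e, y, x) \<in> arcs G"
  by (auto simp: arcs_def)

lemma arcs_same_edge:
  "(e, x, y) \<in> arcs G \<Longrightarrow> (e, x', y') \<in> arcs G \<Longrightarrow> (x' = x \<and> y' = y) \<or> (x' = y \<and> y' = x)"
  by (auto simp: arcs_def doubleton_eq_iff)

lemma walk_arcs: "walk G u as w \<Longrightarrow> set as \<subseteq> arcs G"
  by (induction as arbitrary: u) auto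

lemma walk_end: "walk G u as w \<Longrightarrow> w \<in> verts G"
  by (induction as arbitrary: u) auto

lemma walk_verts_src: "walk G u as w \<Longrightarrow> walk_verts u as = map src as @ [w]"
  by (induction as arbitrary: u) (auto simp: walk_verts_eq)

lemma walk_last: "walk G u as w \<Longrightarrow> last (walk_verts u as) = w"
  by (simp add: walk_verts_src)

lemma set_walk_verts:
  assumes "walk G u as w"
  shows "set (walk_verts u as) = insert u (tgt ` set as)" "set (walk_verts u as) = insert w (src ` set as)"
proof -
  show "set (walk_verts u as) = insert u (tgt ` set as)"
    by (simp add: walk_verts_eq)
  show "set (walk_verts u as) = insert w (src ` set as)"
    using walk_verts_src[OF assms] by simp
qed

lemma arc_in_walk_verts:
  assumes "walk G u as w" "a \<in> set as"
  shows "src a \<in> set (walk_verts u as)" "tgt a \<in> set (walk_verts u as)"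
proof -
  show "src a \<in> set (walk_verts u as)"
    unfolding set_walk_verts(2)[OF assms(1)] using assms(2) by simp
  show "tgt a \<in> set (walk_verts u as)"
    using assms(2) by (simp add: walk_verts_eq)
qed

lemma walk_mono:
  assumes "walk G u as w" "verts G \<subseteq> verts H" "arcs G \<subseteq> arcs H"
  shows "walk H u as w"
  using assms(1) by (induction as arbitrary: u) (use assms(2,3) in auto)

lemma arcs_mono: "edges H \<subseteq> edges G \<Longrightarrow> ends H = ends G \<Longrightarrow> arcs H \<subseteq> arcs G"
  by (auto simp: arcs_def)

text \<open>An oriented cycle with a starting vertex, in list form. Distinct targets alone would
  admit an edge traversed forth and back; distinct edges exclude this.\<close>

definition circuit :: "('v, 'e) multigraph \<Rightarrow> 'v \<Rightarrow> ('e \<times> 'v \<times> 'v) list \<Rightarrow> bool" where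
  "circuit G u as \<longleftrightarrow>
     walk G u as u \<and> as \<noteq> [] \<and> distinct (map fst as) \<and> distinct (map tgt as)"

text \<open>Weak enough to hold for the ambient graph, for the graph with an edge deleted and for
  its cycles.\<close>

locale incidence =
  fixes G :: "('v, 'e) multigraph"
  assumes ends_in_verts: "e \<in> edges G \<Longrightarrow> ends G e \<subseteq> verts G"
begin

lemma arc_verts: "a \<in> arcs G \<Longrightarrow> src a \<in> verts G \<and> tgt a \<in> verts G"
  using ends_in_verts by (fastforce simp: arcs_def)

lemma walk_start: "walk G u as w \<Longrightarrow> u \<in> verts G"
  using arc_verts by (cases as) auto

lemma walk_append_iff:
  "walk G u (as @ bs) w \<longleftrightarrow> (\<exists>v. walk G u as v \<and> walk G v bs w)"
  by (induction as arbitrary: u) (auto dest: walk_start)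

lemma walk_rev_walk: "walk G u as w \<Longrightarrow> walk G w (rev_walk as) u"
proof (induction as arbitrary: u)
  case (Cons a as)
  then show ?case
    using arcs_rev arc_verts by (cases a) (fastforce simp: walk_append_iff)
qed auto

lemma circuit_rotate:
  assumes "circuit G u (p @ q)"
  shows "\<exists>v. circuit G v (q @ p)"
proof -
  from assms obtain v where v: "walk G u p v" "walk G v q u"
    by (auto simp: circuit_def walk_append_iff)
  then have "walk G v (q @ p) v"
    by (auto simp: walk_append_iff)
  then show ?thesis
    using assms by (auto simp: circuit_def)
qed

section \<open>Splitting and reversing paths, and paths as opened circuits\<close>

lemma path_append:
  assumes "is_path G u (p @ q) w"
  obtains v where "is_path G u p v" "is_path G v q w" "walk_verts u (p @ q) = walk_verts u p @ map tgt q"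
    "set (walk_verts u p) \<inter> set (walk_verts v q) = {v}"
proof -
  from assms obtain v where v: "walk G u p v" "walk G v q w"
    by (auto simp: is_path_def walk_append_iff)
  have eq: "walk_verts u (p @ q) = walk_verts u p @ map tgt q"
    by (simp add: walk_verts_eq)
  then have d: "distinct (walk_verts u p @ map tgt q)"
    using assms by (simp add: is_path_def)
  have vin: "v \<in> set (walk_verts u p)"
    unfolding set_walk_verts(2)[OF v(1)] by simp
  then have "distinct (walk_verts v q)"
    using d by (auto simp: walk_verts_eq[of v])
  moreover have "set (walk_verts u p) \<inter> set (walk_verts v q) = {v}"
    using d vin by (auto simp: walk_verts_eq[of v] simp del: set_map)
  ultimately show thesis
    using that[of v] v d eq by (simp add: is_path_def)
qed

lemma path_rev_walk: "is_path G u p w \<Longrightarrow> is_path G w (rev_walk p) u"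
  using walk_rev_walk[of u p w] walk_verts_src[of G u p w]
  by (simp add: is_path_def walk_verts_eq[of w])

lemma path_closed_Nil: "is_path G u p u \<Longrightarrow> p = []"
  using walk_last[of G u p u] last_in_set[of "map tgt p"]
  by (cases "p = []") (auto simp: is_path_def walk_verts_eq)

lemma path_arcs:
  assumes "is_path G u p w" "a \<in> set p"
  shows "src a \<noteq> tgt a" "tgt a \<noteq> u" "src a \<noteq> w"
proof -
  obtain p1 p2 where p: "p = p1 @ a # p2"
    using assms(2) by (meson split_list)
  from assms(1) obtain v where v: "walk G u p1 v" "src a = v" "walk G (tgt a) p2 w"
    by (auto simp: is_path_def walk_append_iff p)
  have d: "distinct (walk_verts u p1 @ walk_verts (tgt a) p2)"
    using assms(1) by (auto simp: is_path_def walk_verts_eq p)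
  have "src a \<in> set (walk_verts u p1)" "u \<in> set (walk_verts u p1)"
    "tgt a \<in> set (walk_verts (tgt a) p2)" "w \<in> set (walk_verts (tgt a) p2)"
    using set_walk_verts[OF v(1)] set_walk_verts[OF v(3)] v(2) by auto
  then show "src a \<noteq> tgt a" "tgt a \<noteq> u" "src a \<noteq> w"
    using d by auto
qed

text \<open>The part before the arc is a closed path at \<open>u\<close> and the part after it one
  at \<open>w\<close>; both are empty by \<open>path_closed_Nil\<close>.\<close>

lemma path_arc_ends:
  assumes "is_path G u p w" "(e, u, w) \<in> set p"
  shows "p = [(e, u, w)]"
proof -
  obtain p1 p2 where p: "p = p1 @ (e, u, w) # p2"
    using assms(2) by (meson split_list)
  obtain v where "is_path G u p1 v" "is_path G v ((e, u, w) # p2) w"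
    using path_append[of u p1 "(e, u, w) # p2" w] assms(1) p by metis
  then have "is_path G u p1 u" "is_path G w p2 w"
    by (auto simp: is_path_def walk_verts_eq)
  then show ?thesis
    using path_closed_Nil p by blast
qed

text \<open>A second use of the first edge would bring the path back to its starting vertex.\<close>

lemma path_distinct_edges: "is_path G u p w \<Longrightarrow> distinct (map fst p)"
proof (induction p arbitrary: u)
  case (Cons a p)
  have p: "is_path G (tgt a) p w"
    using Cons.prems by (auto simp: is_path_def walk_verts_eq)
  have "fst a \<notin> fst ` set p"
  proof
    assume "fst a \<in> fst ` set p"
    then obtain b where b: "b \<in> set p" "fst b = fst a"
      by auto
    have "a \<in> arcs G" "b \<in> arcs G"
      using Cons.prems b walk_arcs[of G u "a # p" w] by (auto simp: is_path_def)
    then have "src a = src b \<or> src a = tgt b"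
      using b arcs_same_edge[of "fst a" "src a" "tgt a" G "src b" "tgt b"] by (metis prod.collapse)
    then have "src a \<in> set (walk_verts (tgt a) p)"
      using set_walk_verts[of G "tgt a" p w] p b by (auto simp: is_path_def)
    then show False
      using Cons.prems by (auto simp: is_path_def walk_verts_eq)
  qed
  then show ?case
    using Cons.IH[OF p] by simp
qed simp

text \<open>Opening a circuit at an arc leaves a path. After \<open>circuit_rotate\<close> this
  applies to each of its arcs.\<close>

lemma circuit_Cons_iff:
  "circuit G u (a # p) \<longleftrightarrow>
     a \<in> arcs G \<and> src a = u \<and> is_path G (tgt a) p u \<and> fst a \<notin> fst ` set p"
  using path_distinct_edges[of "tgt a" p u] by (auto simp: circuit_def is_path_def walk_verts_eq)

lemma circuit_loop:
  assumes "circuit G u as" "(e, x, x) \<in> set as"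
  shows "as = [(e, x, x)]"
proof -
  obtain p q where pq: "as = p @ (e, x, x) # q"
    using assms(2) by (meson split_list)
  then obtain v where "circuit G v (((e, x, x) # q) @ p)"
    using circuit_rotate assms(1) by blast
  then have "is_path G x (q @ p) x"
    by (auto simp: circuit_Cons_iff)
  then have "q @ p = []"
    by (rule path_closed_Nil)
  then show ?thesis
    using pq by simp
qed

text \<open>Two parallel edges are allowed as \<open>p\<close> and \<open>q\<close>. A common edge
  would have both ends in \<open>{s, t}\<close>, and by \<open>path_arc_ends\<close> each path would
  consist of that edge alone, contrary to \<open>p \<noteq> q\<close>.\<close>

lemma circuit_of_paths:
  assumes p: "is_path G s p t" and q: "is_path G s q t" and "p \<noteq> q"
    and disj: "set (walk_verts s p) \<inter> set (walk_verts s q) \<subseteq> {s, t}"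
  shows "circuit G s (p @ rev_walk q)"
proof -
  have wp: "walk G s p t" and wq: "walk G s q t"
    using p q by (auto simp: is_path_def)
  have "s \<noteq> t"
    using p q path_closed_Nil \<open>p \<noteq> q\<close> by blast
  then have "p \<noteq> []"
    using wp by auto
  have "walk G s (p @ rev_walk q) s"
    using wp wq walk_rev_walk walk_append_iff by blast
  \<comment> \<open>\<open>p\<close> contributes its targets, which omit \<open>s\<close>, and the
    reversed \<open>q\<close> contributes its sources, which omit \<open>t\<close>. A vertex common
    to both would have to be \<open>s\<close> or \<open>t\<close>.\<close>
  moreover have "distinct (map tgt (p @ rev_walk q))"
  proof -
    have "distinct (map tgt p)" "s \<notin> tgt ` set p"
      using p by (auto simp: is_path_def walk_verts_eq)
    moreover have "distinct (map src q)" "t \<notin> src ` set q"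
      using q walk_verts_src[OF wq] by (auto simp: is_path_def)
    moreover have "tgt ` set p \<inter> src ` set q \<subseteq> {s, t}"
      using disj unfolding set_walk_verts(1)[OF wp] set_walk_verts(2)[OF wq] by auto
    ultimately show ?thesis
      by (auto simp flip: set_map)
  qed
  moreover have "fst ` set p \<inter> fst ` set q = {}"
  proof (rule ccontr)
    assume "fst ` set p \<inter> fst ` set q \<noteq> {}"
    then obtain e x y x' y' where e: "(e, x, y) \<in> set p" "(e, x', y') \<in> set q"
      by force
    then have "(x' = x \<and> y' = y) \<or> (x' = y \<and> y' = x)"
      using walk_arcs[OF wp] walk_arcs[OF wq] arcs_same_edge[of e x y G x' y'] by blast
    moreover have "{x, y} \<subseteq> set (walk_verts s p)" "{x', y'} \<subseteq> set (walk_verts s q)"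
      using arc_in_walk_verts[OF wp e(1)] arc_in_walk_verts[OF wq e(2)] by simp_all
    ultimately have "{x, y} \<subseteq> {s, t}" "{x', y'} \<subseteq> {s, t}"
      using disj by auto
    then have "x = s \<and> y = t" "x' = s \<and> y' = t"
      using path_arcs[OF p e(1)] path_arcs[OF q e(2)] by auto
    then show False
      using path_arc_ends p q e \<open>p \<noteq> q\<close> by metis
  qed
  ultimately show ?thesis
    using path_distinct_edges[OF p] path_distinct_edges[OF q] \<open>p \<noteq> []\<close>
    by (auto simp: circuit_def simp flip: set_map)
qed


text \<open>A path is rerouted along another one: each step replaces the segment between the first
  point where they part and the first return to the former path.\<close>

lemma path_exchange:
  assumes step: "\<And>r p q r' s t. is_path G y (r @ p @ r') x \<Longrightarrow> is_path G y (r @ q @ r') x \<Longrightarrow>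
      is_path G s q t \<Longrightarrow> circuit G s (p @ rev_walk q) \<Longrightarrow> h (r @ p @ r') = h (r @ q @ r')"
  shows "is_path G y (r @ p) x \<Longrightarrow> is_path G y (r @ q) x \<Longrightarrow> h (r @ p) = h (r @ q)"
\<comment> \<open>The prefix \<open>r\<close> collects what already runs along the second path, so
  \<open>q\<close>, the rest of that path, gets shorter.\<close>
proof (induction "length q" arbitrary: r p q rule: less_induct)
  case less
  obtain s where s: "is_path G y r s" "is_path G s p x"
    using less.prems(1) path_append by metis
  obtain s' where s': "is_path G y r s'" "is_path G s' q x"
    using less.prems(2) path_append by metis
  have "s' = s"
    using s(1) s'(1) walk_last unfolding is_path_def by metis
  with s' have sq: "is_path G s q x"
    by simp
  show ?case
  proof (cases "p = [] \<or> q = []")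
    case True
    then have "s = x"
      using s(2) sq by (auto simp: is_path_def)
    then have "p = []" "q = []"
      using s(2) sq path_closed_Nil[of x] by simp_all
    then show ?thesis
      by simp
  next
    case False
    then obtain a p' b q' where ab: "p = a # p'" "q = b # q'"
      by (meson neq_Nil_conv)
    show ?thesis
    proof (cases "a = b")
      case True
      then have "is_path G y ((r @ [a]) @ p') x" "is_path G y ((r @ [a]) @ q') x"
        using less.prems ab by simp_all
      then have "h ((r @ [a]) @ p') = h ((r @ [a]) @ q')"
        by (rule less.hyps[rotated]) (simp add: ab)
      then show ?thesis
        using ab \<open>a = b\<close> by simp
    next
      case False
      have wp: "walk G s p x" and wq: "walk G s q x"
        using s(2) sq by (auto simp: is_path_def)
      have "x \<noteq> s"
        using sq path_closed_Nil[of s q] ab by auto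
      moreover have "x \<in> set (walk_verts s q)"
        unfolding set_walk_verts(2)[OF wq] by simp
      ultimately have "x \<in> tgt ` set q"
        unfolding set_walk_verts(1)[OF wq] by simp
      moreover have "x \<in> set (walk_verts s p)"
        unfolding set_walk_verts(2)[OF wp] by simp
      ultimately have "\<exists>c\<in>set q. tgt c \<in> set (walk_verts s p)"
        by auto
      \<comment> \<open>\<open>c\<close> is the first arc of \<open>q\<close> that arrives on
        \<open>p\<close>; the vertices reached before it lie off \<open>p\<close>.\<close>
      then obtain q0 c q2 where q: "q = q0 @ c # q2" "tgt c \<in> set (walk_verts s p)"
        "\<And>d. d \<in> set q0 \<Longrightarrow> tgt d \<notin> set (walk_verts s p)"
        using split_list_first_prop[of q "\<lambda>c. tgt c \<in> set (walk_verts s p)"] by blast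
      define t where "t = tgt c"
      \<comment> \<open>Hence some arc of \<open>p\<close> ends at \<open>t\<close>, and
        \<open>p\<close> can be cut there as well.\<close>
      have "t \<noteq> s"
        using path_arcs[OF sq, of c] q by (auto simp: t_def)
      then have "t \<in> tgt ` set p"
        using q(2) set_walk_verts(1)[OF wp] by (simp add: t_def)
      then obtain p0 d p2 where p: "p = p0 @ d # p2" "tgt d = t"
        by (metis imageE split_list)
      define p1 where "p1 = p0 @ [d]"
      define q1 where "q1 = q0 @ [c]"
      have pp: "p = p1 @ p2" and qq: "q = q1 @ q2"
        by (simp_all add: p1_def q1_def p q)
      have p1: "is_path G s p1 t" "is_path G t p2 x"
        using s(2) p by (auto simp: is_path_def walk_append_iff walk_verts_eq p1_def dest: walk_start)
      have q1: "is_path G s q1 t" "is_path G t q2 x"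
        using sq q by (auto simp: is_path_def walk_append_iff walk_verts_eq q1_def t_def dest: walk_start)
      have "hd p1 = a" "hd q1 = b"
        using ab p q by (cases p0; cases q0; auto simp: p1_def q1_def)+
      then have "p1 \<noteq> q1"
        using False by auto
      have "set (walk_verts s p1) \<subseteq> set (walk_verts s p)"
        by (auto simp: walk_verts_eq pp)
      moreover have "set (walk_verts s q1) \<subseteq> insert s (insert t (tgt ` set q0))"
        by (auto simp: walk_verts_eq q1_def t_def)
      ultimately have "set (walk_verts s p1) \<inter> set (walk_verts s q1) \<subseteq> {s, t}"
        using q(3) by fastforce
      then have circ: "circuit G s (p1 @ rev_walk q1)"
        using circuit_of_paths p1 q1 \<open>p1 \<noteq> q1\<close> by blast
      have "walk G y (r @ q1 @ p2) x"
        using s(1) q1(1) p1(2) by (auto simp: walk_append_iff is_path_def)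
      \<comment> \<open>The vertices that \<open>q1\<close> adds avoid \<open>r\<close>, because
        \<open>r @ q\<close> is a path, and avoid \<open>p2\<close> beyond \<open>t\<close>, because
        \<open>q0\<close> stays off \<open>p\<close>.\<close>
      moreover have "distinct (walk_verts y (r @ q1 @ p2))"
      proof -
        have "distinct (walk_verts y r @ map tgt q1)" "set (walk_verts y r) \<inter> tgt ` set p2 = {}"
          using less.prems by (auto simp: walk_verts_eq is_path_def pp qq)
        moreover have "distinct (map tgt p2)" "t \<notin> tgt ` set p2"
          using p1(2) by (auto simp: walk_verts_eq is_path_def)
        moreover have "tgt ` set q0 \<inter> tgt ` set p2 = {}"
        proof -
          have "tgt ` set p2 \<subseteq> set (walk_verts s p)"
            by (auto simp: walk_verts_eq pp)
          then show ?thesis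
            using q(3) by auto
        qed
        ultimately show ?thesis
          by (auto simp: walk_verts_eq q1_def t_def simp flip: set_map)
      qed
      ultimately have mid: "is_path G y (r @ q1 @ p2) x"
        by (simp add: is_path_def)
      have "h (r @ p) = h (r @ q1 @ p2)"
        using step[of r p1 p2 q1] less.prems(1) mid q1(1) circ by (simp add: pp)
      also have "\<dots> = h (r @ q)"
        using less.hyps[of q2 "r @ q1" p2] mid less.prems(2) by (simp add: q1_def q)
      finally show ?thesis .
    qed
  qed
qed

end

section \<open>Theta-additive functions come from integer gainings\<close>

text \<open>The case \<open>m = 0\<close> covers functions that are skew-symmetric over the integers.\<close>

lemma sum_list_rev_walk:
  fixes \<kappa> :: "'e \<times> 'v \<times> 'v \<Rightarrow> int"
  assumes "\<And>e x y. (e, x, y) \<in> arcs G \<Longrightarrow> x \<noteq> y \<Longrightarrow> m dvd \<kappa> (e, x, y) + \<kappa> (e, y, x)"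
    and "set as \<subseteq> arcs G" "\<forall>a\<in>set as. src a \<noteq> tgt a"
  shows "m dvd sum_list (map \<kappa> as) + sum_list (map \<kappa> (rev_walk as))"
  using assms(2,3)
proof (induction as)
  case (Cons a as)
  obtain e x y where a: "a = (e, x, y)"
    by (cases a)
  have "m dvd (\<kappa> (e, x, y) + \<kappa> (e, y, x)) + (sum_list (map \<kappa> as) + sum_list (map \<kappa> (rev_walk as)))"
    by (rule dvd_add) (use Cons assms(1)[of e x y] in \<open>simp_all add: a\<close>)
  then show ?case
    by (simp add: a algebra_simps)
qed simp

section \<open>Transfer of walks between a graph and a subgraph\<close>

lemma circuit_mono:
  assumes "circuit H u as" "verts H \<subseteq> verts G" "arcs H \<subseteq> arcs G"
  shows "circuit G u as"
  using assms walk_mono by (auto simp: circuit_def)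

lemma path_mono:
  assumes "is_path H u as w" "verts H \<subseteq> verts G" "arcs H \<subseteq> arcs G"
  shows "is_path G u as w"
  using assms walk_mono by (auto simp: is_path_def)

lemma walk_restrict:
  assumes "walk G u as w" "ends H = ends G" "fst ` set as \<subseteq> edges H" "w \<in> verts H"
  shows "walk H u as w"
  using assms by (induction as arbitrary: u) (auto simp: arcs_def)

text \<open>\<open>f\<close> prescribes a value for each oriented cycle. It has to be independent of
  the starting vertex, change sign under reversal, and be additive on a theta graph, two of whose
  circuits share \<open>r\<close> and \<open>r'\<close> and differ in \<open>p\<close> and
  \<open>q\<close>. Reversal leaves out loops: a loop is its own reversal and may have any
  value.\<close>

lemma theta_additive_imp_potential:
  fixes f :: "('e \<times> 'v \<times> 'v) list \<Rightarrow> int"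
  assumes "finite (edges G)" "incidence G"
    and "\<And>u p q. circuit G u (p @ q) \<Longrightarrow> f (q @ p) = f (p @ q)"
    and "\<And>u as. circuit G u as \<Longrightarrow> \<forall>a\<in>set as. src a \<noteq> tgt a \<Longrightarrow> f (rev_walk as) = - f as"
    and "\<And>u s t r p q r'. circuit G u (r @ p @ r') \<Longrightarrow> circuit G u (r @ q @ r') \<Longrightarrow>
      is_path G s q t \<Longrightarrow> circuit G s (p @ rev_walk q) \<Longrightarrow>
      f (r @ p @ r') - f (r @ q @ r') = f (p @ rev_walk q)"
  shows "\<exists>\<kappa>. (\<forall>e x y. x \<noteq> y \<longrightarrow> \<kappa> (e, y, x) = - \<kappa> (e, x, y)) \<and>
    (\<forall>u as. circuit G u as \<longrightarrow> sum_list (map \<kappa> as) = f as)"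
proof -
  define E where "E = edges G"
  have "finite E" "edges G = E"
    using assms(1) by (auto simp: E_def)
  from this assms(2-) show ?thesis
  proof (induction E arbitrary: G rule: finite_induct)
    case empty
    then have "\<not> circuit G u as" for u as
      by (cases as) (auto simp: circuit_def arcs_def)
    then show ?case
      by (intro exI[of _ "\<lambda>_. 0"]) auto
  next
    case (insert e E)
    interpret incidence G
      by fact
    note rot = insert.prems(3) and rev = insert.prems(4) and theta = insert.prems(5)
    define H where "H = G\<lparr>edges := E\<rparr>"
    have H: "verts H \<subseteq> verts G" "arcs H \<subseteq> arcs G"
      using insert.prems(1) by (auto simp: H_def arcs_def)
    have edges_H: "edges H = E"
      by (simp add: H_def)
    interpret H: incidence H
    proof
      show "ends H e' \<subseteq> verts H" if "e' \<in> edges H" for e'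
        using that ends_in_verts[of e'] insert.prems(1) by (simp add: H_def)
    qed
    have circuit_G: "circuit H u as \<Longrightarrow> circuit G u as" for u as
      by (rule circuit_mono) (use H in auto)
    have path_G: "is_path H u as w \<Longrightarrow> is_path G u as w" for u as w
      by (rule path_mono) (use H in auto)
    have edges_sub: "fst ` set as \<subseteq> E" if "walk G u as w" "e \<notin> fst ` set as" for u as w
    proof
      fix e' assume "e' \<in> fst ` set as"
      then obtain a where "a \<in> set as" "e' = fst a"
        by blast
      then have "e' \<in> edges G" "e' \<noteq> e"
        using walk_arcs[OF that(1)] that(2) by (auto simp: arcs_def)
      then show "e' \<in> E"
        using insert.prems(1) by simp
    qed
    have walk_H: "walk H u as w" if "walk G u as w" "e \<notin> fst ` set as" for u as w
      by (rule walk_restrict[OF that(1)])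
        (use edges_sub[OF that] walk_end[OF that(1)] in \<open>simp_all add: H_def\<close>)
    have circuit_H: "circuit H u as" if "circuit G u as" "e \<notin> fst ` set as" for u as
      using that walk_H by (simp add: circuit_def)
    have path_H: "is_path H u as w" if "is_path G u as w" "e \<notin> fst ` set as" for u as w
      using that walk_H by (simp add: is_path_def)
    have e_notin: "e \<notin> fst ` set as" if "is_path H u as w" for u as w
    proof -
      have "set as \<subseteq> arcs H"
        using that walk_arcs[of H u as w] by (simp add: is_path_def)
      then show ?thesis
        using insert.hyps(2) by (auto simp: arcs_def edges_H)
    qed
    have "\<exists>\<kappa>. (\<forall>e x y. x \<noteq> y \<longrightarrow> \<kappa> (e, y, x) = - \<kappa> (e, x, y)) \<and>
        (\<forall>u as. circuit H u as \<longrightarrow> sum_list (map \<kappa> as) = f as)"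
    proof (rule insert.IH[OF edges_H])
      show "incidence H" ..
      show "f (q @ p) = f (p @ q)" if "circuit H u (p @ q)" for u p q
        using rot[OF circuit_G[OF that]] .
      show "f (rev_walk as) = - f as" if "circuit H u as" "\<forall>a\<in>set as. src a \<noteq> tgt a" for u as
        using rev[OF circuit_G[OF that(1)] that(2)] .
      show "f (r @ p @ r') - f (r @ q @ r') = f (p @ rev_walk q)"
        if "circuit H u (r @ p @ r')" "circuit H u (r @ q @ r')" "is_path H s q t"
          "circuit H s (p @ rev_walk q)" for u s t r p q r'
        using theta[OF circuit_G[OF that(1)] circuit_G[OF that(2)] path_G[OF that(3)]
            circuit_G[OF that(4)]] .
    qed
    then obtain \<kappa> where skew: "\<And>e x y. x \<noteq> y \<Longrightarrow> \<kappa> (e, y, x) = - \<kappa> (e, x, y)"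
      and \<kappa>: "\<And>u as. circuit H u as \<Longrightarrow> sum_list (map \<kappa> as) = f as"
      by blast
    have \<kappa>_rev: "sum_list (map \<kappa> (rev_walk p)) = - sum_list (map \<kappa> p)" if "is_path H s p t" for s p t
    proof -
      have "0 dvd sum_list (map \<kappa> p) + sum_list (map \<kappa> (rev_walk p))"
      proof (rule sum_list_rev_walk)
        show "0 dvd \<kappa> (e, x, y) + \<kappa> (e, y, x)" if "x \<noteq> y" for e x y
          using skew[OF that, of e] by simp
        show "set p \<subseteq> arcs H"
          using that walk_arcs[of H s p t] by (simp add: is_path_def)
      qed (use H.path_arcs(1)[OF that] in blast)
      then show ?thesis
        by simp
    qed
    \<comment> \<open>The case condition says that some circuit of \<open>G\<close> passes through
      \<open>e\<close>. Without one, \<open>\<kappa>\<close> itself serves for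
      \<open>G\<close>.\<close>
    show ?case
    proof (cases "\<exists>x y P. (e, x, y) \<in> arcs G \<and> is_path H y P x")
      case False
      have e_notin_circuit: "e \<notin> fst ` set as" if as: "circuit G u as" for u as
      proof
        assume "e \<in> fst ` set as"
        then obtain p x y q where "as = p @ (e, x, y) # q"
          by (auto dest!: split_list)
        then obtain v where "circuit G v ((e, x, y) # q @ p)"
          using circuit_rotate[of u p "(e, x, y) # q"] as by auto
        then have "(e, x, y) \<in> arcs G" "is_path H y (q @ p) x"
          using path_H[of y "q @ p" x] by (auto simp: circuit_Cons_iff)
        then show False
          using False by blast
      qed
      then have "sum_list (map \<kappa> as) = f as" if "circuit G u as" for u as
        using \<kappa>[OF circuit_H[OF that]] that by simp
      then show ?thesis
        using skew by blast
    next
      case True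
      then obtain x y P0 where exy: "(e, x, y) \<in> arcs G" and P0: "is_path H y P0 x"
        by blast
      \<comment> \<open>The value on \<open>e\<close> that is forced by the one circuit closed by
        \<open>P0\<close>.\<close>
      define d where "d = f ((e, x, y) # P0) - sum_list (map \<kappa> P0)"
      \<comment> \<open>For a loop both arcs are \<open>(e, x, y)\<close>, and the order of the
        tests gives it the value \<open>d\<close>.\<close>
      define \<kappa>' where "\<kappa>' a = (if a = (e, x, y) then d else if a = (e, y, x) then - d else \<kappa> a)" for a
      have \<kappa>'_eq: "sum_list (map \<kappa>' as) = sum_list (map \<kappa> as)" if "e \<notin> fst ` set as" for as
      proof -
        have "map \<kappa>' as = map \<kappa> as"
        proof (rule map_cong[OF refl])
          fix a assume "a \<in> set as"
          then have "fst a \<noteq> e"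
            using that by blast
          then show "\<kappa>' a = \<kappa> a"
            by (cases a) (simp add: \<kappa>'_def)
        qed
        then show ?thesis
          by (rule arg_cong)
      qed
      have circ: "circuit G x ((e, x, y) # P)" if "is_path H y P x" for P
        using exy path_G[OF that] e_notin[OF that] by (simp add: circuit_Cons_iff)
      \<comment> \<open>Every other \<open>P\<close> yields the same \<open>d\<close>: an exchange
        step changes \<open>f\<close> by its value on \<open>p @ rev_walk q\<close>, a circuit of
        \<open>H\<close>, where \<open>f\<close> is already the sum of
        \<open>\<kappa>\<close>.\<close>
      have fP: "f ((e, x, y) # P) = d + sum_list (map \<kappa> P)" if P: "is_path H y P x" for P
      proof -
        have "f ((e, x, y) # [] @ P) - sum_list (map \<kappa> ([] @ P)) =
          f ((e, x, y) # [] @ P0) - sum_list (map \<kappa> ([] @ P0))"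
        proof (rule H.path_exchange[where y = y and x = x
              and h = "\<lambda>P. f ((e, x, y) # P) - sum_list (map \<kappa> P)"])
          fix r p q r' s t
          assume *: "is_path H y (r @ p @ r') x" "is_path H y (r @ q @ r') x"
            "is_path H s q t" "circuit H s (p @ rev_walk q)"
          have "f (((e, x, y) # r) @ p @ r') - f (((e, x, y) # r) @ q @ r') = f (p @ rev_walk q)"
            by (rule theta[of x _ _ _ _ s t]) (use circ[OF *(1)] circ[OF *(2)] path_G[OF *(3)] circuit_G[OF *(4)] in simp_all)
          also have "\<dots> = sum_list (map \<kappa> p) - sum_list (map \<kappa> q)"
            using \<kappa>[OF *(4)] \<kappa>_rev[OF *(3)] by simp
          finally show "f ((e, x, y) # r @ p @ r') - sum_list (map \<kappa> (r @ p @ r')) =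
              f ((e, x, y) # r @ q @ r') - sum_list (map \<kappa> (r @ q @ r'))"
            by simp
        qed (use P P0 in simp_all)
        then show ?thesis
          by (simp add: d_def)
      qed
      have "sum_list (map \<kappa>' as) = f as" if as: "circuit G u as" for u as
      proof (cases "e \<in> fst ` set as")
        case False
        then show ?thesis
          using \<kappa>'_eq[OF False] \<kappa>[OF circuit_H[OF as False]] by simp
      next
        case True
        then obtain p x' y' q where pq: "as = p @ (e, x', y') # q"
          by (auto dest!: split_list)
        let ?P = "q @ p"
        obtain v where v: "circuit G v ((e, x', y') # ?P)"
          using circuit_rotate[of u p "(e, x', y') # q"] as pq by auto
        have f_as: "f as = f ((e, x', y') # ?P)"
          using rot[of u p "(e, x', y') # q"] as pq by simp
        have \<kappa>'_as: "sum_list (map \<kappa>' as) = \<kappa>' (e, x', y') + sum_list (map \<kappa>' ?P)"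
          by (simp add: pq)
        have e: "(e, x', y') \<in> arcs G" "e \<notin> fst ` set ?P" and P: "is_path H y' ?P x'"
          using v path_H[of y' ?P x'] by (auto simp: circuit_Cons_iff)
        have v_eq: "v = x'"
          using v by (simp add: circuit_Cons_iff)
        consider "x' = x" "y' = y" | "x' = y" "y' = x" "x \<noteq> y"
          using arcs_same_edge[OF exy e(1)] by blast
        then show ?thesis
        proof cases
          case 1
          then show ?thesis
            using f_as \<kappa>'_as \<kappa>'_eq[OF e(2)] fP[of ?P] P by (simp add: \<kappa>'_def)
        next
          case 2
          \<comment> \<open>The circuit passes \<open>e\<close> against the direction in which
            \<open>d\<close> was fixed. Its reversal, rotated until \<open>e\<close> comes first, is
            covered by \<open>fP\<close>.\<close>
          have P': "is_path H y (rev_walk ?P) x"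
            using H.path_rev_walk[OF P] 2 by simp
          have "\<forall>a\<in>set ((e, x', y') # ?P). src a \<noteq> tgt a"
            using H.path_arcs(1)[OF P] 2 by auto
          then have "f (rev_walk ((e, x', y') # ?P)) = - f ((e, x', y') # ?P)"
            using rev[OF v] by blast
          moreover have "f (rev_walk ?P @ [(e, x, y)]) = f ((e, x, y) # rev_walk ?P)"
            using rot[of x "[(e, x, y)]" "rev_walk ?P"] circ[OF P'] by simp
          ultimately have "f ((e, x', y') # ?P) = - d - sum_list (map \<kappa> (rev_walk ?P))"
            using fP[OF P'] 2 by simp
          then show ?thesis
            using f_as \<kappa>'_as \<kappa>'_eq[OF e(2)] \<kappa>_rev[OF P] 2 by (simp add: \<kappa>'_def)
        qed
      qed
      moreover have "\<kappa>' (e', y', x') = - \<kappa>' (e', x', y')" if "x' \<noteq> y'" for e' x' y'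
      proof -
        consider "e' = e" "x' = x" "y' = y" | "e' = e" "x' = y" "y' = x"
          | "(e', x', y') \<noteq> (e, x, y)" "(e', x', y') \<noteq> (e, y, x)"
          by blast
        then show ?thesis
        proof cases
          case 3
          then have "(e', y', x') \<noteq> (e, x, y)" "(e', y', x') \<noteq> (e, y, x)"
            by auto
          with 3 show ?thesis
            unfolding \<kappa>'_def using skew[OF that] by presburger
        qed (use that in \<open>auto simp: \<kappa>'_def\<close>)
      qed
      ultimately show ?thesis
        by (intro exI[of _ \<kappa>'] conjI allI impI)
    qed
  qed
qed

section \<open>Circuits and cycles\<close>

text \<open>Each edge is traversed once and contributes the source and the target of its arc. For a
  loop these coincide, which matches its double count in \<open>degree\<close>.\<close>

lemma degree_eq_count_arcs:
  assumes "set as \<subseteq> arcs C" "distinct (map fst as)" "fst ` set as = edges C"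
  shows "degree C v = count_list (map src as) v + count_list (map tgt as) v"
proof -
  have card: "card {e \<in> edges C. P e} = length (filter P (map fst as))" for P
    using distinct_card[of "filter P (map fst as)"] assms(2) by (simp flip: assms(3))
  have "length (filter (\<lambda>e. v \<in> ends C e) (map fst as)) + length (filter (\<lambda>e. ends C e = {v}) (map fst as))
      = count_list (map src as) v + count_list (map tgt as) v"
    using assms(1) by (induction as) (auto simp: arcs_def)
  then show ?thesis
    unfolding degree_def card .
qed

text \<open>Prefixing \<open>u\<close> to the targets and appending \<open>u\<close> to the sources
  give the same list of vertices.\<close>

lemma closed_walk_mset:
  assumes "walk G u as u"
  shows "mset (map src as) = mset (map tgt as)"
proof -
  have "mset (u # map tgt as) = mset (map src as @ [u])"
    using walk_verts_src[OF assms] by (simp only: walk_verts_eq)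
  then show ?thesis
    by simp
qed

lemma closed_walk_count: "walk G u as u \<Longrightarrow> count_list (map src as) v = count_list (map tgt as) v"
  using closed_walk_mset by (metis count_mset)

lemma subgraph_incidence: "subgraph H G \<Longrightarrow> incidence H"
  unfolding subgraph_def incidence_def by metis

lemma subgraph_arcs: "subgraph H G \<Longrightarrow> arcs H \<subseteq> arcs G"
  by (intro arcs_mono) (auto simp: subgraph_def)

text \<open>Vertices occur equally often as source and as target in a closed walk, so degree two
  means that each vertex is entered exactly once. The empty walk would give degree zero.\<close>

lemma simple_closed_walk_imp_circuit:
  assumes "is_cycle G C" "simple_closed_walk C u as"
  shows "circuit C u as"
proof -
  have as: "walk C u as u" "distinct (map fst as)" "fst ` set as = edges C"
    using assms(2) by (auto simp: simple_closed_walk_def walk_edges_def)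
  have C: "incidence C" "verts C \<noteq> {}" "\<And>v. v \<in> verts C \<Longrightarrow> degree C v = 2"
    using assms(1) subgraph_incidence by (auto simp: is_cycle_def)
  have deg: "degree C v = 2 * count_list (map tgt as) v" for v
    using degree_eq_count_arcs[OF walk_arcs[OF as(1)] as(2,3)] closed_walk_count[OF as(1)] by simp
  have "as \<noteq> []"
    using C(2,3) deg by fastforce
  moreover have "distinct (map tgt as)"
  proof -
    have "count_list (map tgt as) v = 1" if "v \<in> set (map tgt as)" for v
    proof -
      have "v \<in> verts C"
        using that walk_arcs[OF as(1)] incidence.arc_verts[OF C(1)] by auto
      then show ?thesis
        using C(3)[of v] deg[of v] by simp
    qed
    then show ?thesis
      unfolding distinct_count_atmost_1 count_mset using count_notin by fastforce
  qed
  ultimately show ?thesis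
    using as by (simp add: circuit_def)
qed

lemma circuit_imp_cycle:
  assumes "incidence G" "circuit G u as"
  obtains C where "is_cycle G C" "simple_closed_walk C u as"
proof -
  interpret incidence G
    by fact
  have as: "walk G u as u" "as \<noteq> []" "distinct (map fst as)" "distinct (map tgt as)"
    using assms(2) by (auto simp: circuit_def)
  \<comment> \<open>Only the vertices and edges are cut down; \<open>ends\<close> is kept, as
    \<open>subgraph\<close> requires.\<close>
  define C where "C = G\<lparr>verts := tgt ` set as, edges := fst ` set as\<rparr>"
  have "set (map src as) = set (map tgt as)"
    using closed_walk_mset[OF as(1)] by (metis set_mset_mset)
  then have src_tgt: "src ` set as = tgt ` set as"
    by simp
  have "u \<in> src ` set as"
    using as(1,2) by (cases as) auto
  then have u: "u \<in> verts C"
    by (simp add: C_def src_tgt)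
  have walk_C: "walk C u as u"
    by (rule walk_restrict[OF as(1)]) (use u in \<open>simp_all add: C_def\<close>)
  have arcs: "set as \<subseteq> arcs C"
    by (rule walk_arcs) (fact walk_C)
  have ends_C: "ends C e \<subseteq> verts C" if "e \<in> edges C" for e
  proof -
    from that obtain a where a: "a \<in> set as" "fst a = e"
      by (auto simp: C_def)
    then have "ends C e = {src a, tgt a}"
      using arcs by (cases a) (auto simp: arcs_def)
    moreover have "src a \<in> tgt ` set as"
      using a by (simp flip: src_tgt)
    ultimately show ?thesis
      using a by (simp add: C_def)
  qed
  have sub: "subgraph C G"
    unfolding subgraph_def
  proof (intro conjI ballI)
    show "verts C \<subseteq> verts G" "edges C \<subseteq> edges G"
      using walk_arcs[OF as(1)] arc_verts by (auto simp: C_def arcs_def)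
  qed (use ends_C in \<open>auto simp: C_def\<close>)
  interpret C: incidence C
    using sub by (rule subgraph_incidence)
  \<comment> \<open>Connectedness goes through \<open>u\<close>: the circuit leads from
    \<open>u\<close> to every vertex and from there back to \<open>u\<close>.\<close>
  have both: "(\<exists>p. walk C u p v) \<and> (\<exists>q. walk C v q u)" if "v \<in> verts C" for v
  proof -
    from that obtain a where "a \<in> set as" "v = tgt a"
      by (auto simp: C_def)
    then obtain p q where pq: "as = (p @ [a]) @ q" "v = tgt a"
      by (auto dest!: split_list)
    then obtain v' where "walk C u (p @ [a]) v'" "walk C v' q u"
      using walk_C C.walk_append_iff by blast
    moreover from this have "v' = v"
      using pq by (auto simp: C.walk_append_iff)
    ultimately show ?thesis
      by blast
  qed
  have "connected_graph C"
    unfolding connected_graph_def using both C.walk_append_iff by blast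
  moreover have "degree C v = 2" if "v \<in> verts C" for v
  proof -
    have "degree C v = 2 * count_list (map tgt as) v"
      using degree_eq_count_arcs[OF arcs as(3)] closed_walk_count[OF as(1)] by (simp add: C_def)
    moreover have "count_list (map tgt as) v = 1"
      using as(4) that unfolding distinct_count_atmost_1 count_mset by (simp add: C_def)
    ultimately show ?thesis
      by simp
  qed
  ultimately have "is_cycle G C"
    using sub u by (auto simp: is_cycle_def)
  moreover have "simple_closed_walk C u as"
    using walk_C as by (simp add: simple_closed_walk_def walk_edges_def C_def)
  ultimately show thesis
    by (rule that)
qed

text \<open>The direction propagates. The circuit passes the next edge of the walk either in the
  same direction or towards the vertex just reached. It enters that vertex only by the arc just
  used, so in the latter case the walk would repeat an edge.\<close>

lemma circuit_contains_walk:
  assumes as: "circuit G u as"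
  shows "walk G v (b # bs) w \<Longrightarrow> distinct (map fst (b # bs)) \<Longrightarrow> fst ` set (b # bs) \<subseteq> fst ` set as \<Longrightarrow>
    b \<in> set as \<Longrightarrow> set (b # bs) \<subseteq> set as"
proof (induction bs arbitrary: b v)
  case (Cons c bs)
  have inj: "inj_on tgt (set as)"
    using as by (simp add: circuit_def distinct_map)
  obtain c' where c': "c' \<in> set as" "fst c' = fst c"
    using Cons.prems(3) by auto
  have "c' \<in> arcs G" "c \<in> arcs G" "src c = tgt b"
    using c'(1) as Cons.prems(1) walk_arcs[of G u as u] by (auto simp: circuit_def)
  then have "c' = c \<or> tgt c' = tgt b"
    using c'(2) arcs_same_edge[of "fst c" "src c" "tgt c" G "src c'" "tgt c'"]
    by (metis prod.collapse)
  moreover have "tgt c' \<noteq> tgt b"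
  proof
    assume "tgt c' = tgt b"
    then have "c' = b"
      using inj c'(1) Cons.prems(4) by (simp add: inj_on_def)
    then show False
      using c'(2) Cons.prems(2) by simp
  qed
  ultimately have "c \<in> set as"
    using c'(1) by simp
  then show ?case
    using Cons.IH[of "tgt b" c] Cons.prems by simp
qed simp

lemma circuits_same_arcs:
  assumes as: "circuit G u as" and bs: "circuit G v bs" and edges: "fst ` set bs = fst ` set as"
    and b: "b \<in> set as" "b = hd bs"
  shows "set bs = set as"
proof
  obtain bs' where bs': "bs = b # bs'"
    using bs b by (cases bs) (auto simp: circuit_def)
  show sub: "set bs \<subseteq> set as"
    unfolding bs'
  proof (rule circuit_contains_walk[OF as])
    show "walk G v (b # bs') v" "distinct (map fst (b # bs'))"
      using bs unfolding circuit_def bs' by blast+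
    show "fst ` set (b # bs') \<subseteq> fst ` set as"
      using edges unfolding bs' by simp
  qed (fact b)
  have inj: "inj_on fst (set as)"
    using as by (simp add: circuit_def distinct_map)
  show "set as \<subseteq> set bs"
  proof
    fix a assume a: "a \<in> set as"
    then obtain c where "c \<in> set bs" "fst c = fst a"
      using edges by (metis imageE imageI)
    then show "a \<in> set bs"
      using a sub inj by (metis inj_onD subsetD)
  qed
qed

text \<open>According to the direction in which they pass one common edge, the circuits have the
  same arcs or opposite ones. The sums are then equal, or opposite modulo \<open>m\<close>.\<close>

lemma circuits_sum_dvd_iff:
  fixes \<kappa> :: "'e \<times> 'v \<times> 'v \<Rightarrow> int"
  assumes "incidence G"
    and as: "circuit G u as" and bs: "circuit G v bs" and edges: "fst ` set bs = fst ` set as"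
    and skew: "\<And>e x y. (e, x, y) \<in> arcs G \<Longrightarrow> x \<noteq> y \<Longrightarrow> m dvd \<kappa> (e, x, y) + \<kappa> (e, y, x)"
  shows "m dvd sum_list (map \<kappa> bs) \<longleftrightarrow> m dvd sum_list (map \<kappa> as)"
proof -
  interpret incidence G
    by fact
  have sum_eq: "sum_list (map \<kappa> bs) = sum_list (map \<kappa> cs)" if "circuit G w cs" "set bs = set cs" for w cs
  proof -
    have "distinct bs" "distinct cs"
      using bs that by (auto simp: circuit_def distinct_map)
    then show ?thesis
      using that(2) by (simp add: sum_list_distinct_conv_sum_set)
  qed
  obtain e x y where b: "hd bs = (e, x, y)"
    by (cases "hd bs")
  then have b_in: "(e, x, y) \<in> set bs"
    using bs by (cases bs) (auto simp: circuit_def)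
  then obtain x' y' where a: "(e, x', y') \<in> set as"
    using edges by force
  have arcs: "set as \<subseteq> arcs G" "set bs \<subseteq> arcs G"
    using as bs walk_arcs[of G u as u] walk_arcs[of G v bs v] unfolding circuit_def by simp_all
  then consider "(e, x, y) \<in> set as" | "(e, y, x) \<in> set as" "x \<noteq> y"
    using arcs_same_edge[of e x y G x' y'] a b_in by blast
  then show ?thesis
  proof cases
    case 1
    then show ?thesis
      using circuits_same_arcs[OF as bs edges] sum_eq[OF as] b by simp
  next
    case 2
    \<comment> \<open>By \<open>circuit_loop\<close> a loop would be all of \<open>as\<close>, which
      contains the non-loop arc \<open>(e, y, x)\<close>.\<close>
    have no_loop: "src a \<noteq> tgt a" if "a \<in> set as" for a
    proof
      assume "src a = tgt a"
      then have "as = [a]"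
        using circuit_loop[OF as, of "fst a" "src a"] that by (cases a) auto
      then show False
        using 2 \<open>src a = tgt a\<close> by auto
    qed
    have "mset (map src as) = mset (map tgt as)"
      using as closed_walk_mset[of G u as] by (simp add: circuit_def)
    then have "distinct (map src as)"
      using as mset_eq_imp_distinct_iff by (metis circuit_def)
    then have rev: "circuit G u (rev_walk as)"
      using as walk_rev_walk by (simp add: circuit_def)
    have "fst ` set (rev_walk as) = fst ` set as"
      by (metis list.set_map map_fst_rev_walk set_rev)
    moreover have "(e, x, y) \<in> set (rev_walk as)"
      using 2 by (force simp: set_rev_walk)
    ultimately have "sum_list (map \<kappa> bs) = sum_list (map \<kappa> (rev_walk as))"
      using circuits_same_arcs[OF rev bs] sum_eq[OF rev] edges b by simp
    moreover have "m dvd sum_list (map \<kappa> as) + sum_list (map \<kappa> (rev_walk as))"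
      by (rule sum_list_rev_walk[of G]) (use skew arcs no_loop in blast)+
    ultimately show ?thesis
      by (metis dvd_add_left_iff dvd_add_right_iff)
  qed
qed

section \<open>Gains modulo 3 and 4\<close>

lemma walk_gain_integer_mod_group:
  "n > 0 \<Longrightarrow> walk_gain (integer_mod_group n) \<gamma> as = sum_list (map \<gamma> as) mod int n"
  by (induction as) (simp_all add: mod_add_right_eq)

lemma gaining_integer_mod_group_skew:
  assumes "gaining (integer_mod_group n) G \<gamma>" "(e, x, y) \<in> arcs G" "x \<noteq> y"
  shows "int n dvd \<gamma> (e, x, y) + \<gamma> (e, y, x)"
proof -
  have "\<gamma> (e, y, x) = (- \<gamma> (e, x, y)) mod int n"
    using assms by (force simp: gaining_def)
  then show ?thesis
    by (simp add: dvd_eq_mod_eq_0 mod_add_right_eq)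
qed

text \<open>\<open>balanced_cycles\<close> quantifies over all simple closed walks of a cycle; by
  \<open>circuits_sum_dvd_iff\<close> a single one decides.\<close>

lemma balanced_iff_circuit_dvd:
  assumes "n > 0" "gaining (integer_mod_group n) G \<gamma>" "is_cycle G C" "simple_closed_walk C u as"
  shows "C \<in> balanced_cycles (integer_mod_group n) G \<gamma> \<longleftrightarrow> int n dvd sum_list (map \<gamma> as)"
proof -
  have C: "incidence C" "arcs C \<subseteq> arcs G"
    using assms(3) subgraph_incidence[of C G] subgraph_arcs[of C G] by (simp_all add: is_cycle_def)
  have "int n dvd sum_list (map \<gamma> bs) \<longleftrightarrow> int n dvd sum_list (map \<gamma> as)"
    if "simple_closed_walk C v bs" for v bs
  proof (rule circuits_sum_dvd_iff[OF C(1)])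
    show "circuit C u as" "circuit C v bs"
      by (fact simple_closed_walk_imp_circuit[OF assms(3,4)] simple_closed_walk_imp_circuit[OF assms(3) that])+
    show "fst ` set bs = fst ` set as"
      using that assms(4) by (simp add: simple_closed_walk_def walk_edges_def)
    show "int n dvd \<gamma> (e, x, y) + \<gamma> (e, y, x)" if "(e, x, y) \<in> arcs C" "x \<noteq> y" for e x y
      using gaining_integer_mod_group_skew[OF assms(2)] that C(2) by blast
  qed
  moreover have "C \<in> balanced_cycles (integer_mod_group n) G \<gamma> \<longleftrightarrow>
      (\<forall>v bs. simple_closed_walk C v bs \<longrightarrow> int n dvd sum_list (map \<gamma> bs))"
    using assms(1,3) by (simp add: balanced_cycles_def walk_gain_integer_mod_group dvd_eq_mod_eq_0)
  ultimately show ?thesis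
    using assms(4) by blast
qed

text \<open>Meaningful only if \<open>3 dvd i \<longleftrightarrow> 4 dvd j\<close>: then \<open>theta_lift i j\<close> is congruent to \<open>i\<close> modulo 3, because
  \<open>- 2 * s\<close> and \<open>s\<close> are.\<close>

definition theta_lift :: "int \<Rightarrow> int \<Rightarrow> int" where
  "theta_lift i j =
     (let s = if i mod 3 = 1 then 1 else - 1
      in if j mod 4 = 0 then 0 else if j mod 4 = 2 then - 2 * s else s)"

lemma theta_lift_cong: "i mod 3 = i' mod 3 \<Longrightarrow> j mod 4 = j' mod 4 \<Longrightarrow> theta_lift i j = theta_lift i' j'"
  by (simp add: theta_lift_def)

text \<open>The hypotheses express that each of the three cycles of a theta graph is balanced for
  both gains or for neither. If one is balanced, it remains that \<open>theta_lift\<close> depends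
  only on residues and is odd on consistent pairs. Otherwise two values have size 1 and one has size
  2, and the residues modulo 3 determine the signs.\<close>

lemma theta_lift_diff:
  assumes "3 dvd i \<longleftrightarrow> 4 dvd j" "3 dvd i' \<longleftrightarrow> 4 dvd j'" "3 dvd i - i' \<longleftrightarrow> 4 dvd j - j'"
  shows "theta_lift (i - i') (j - j') = theta_lift i j - theta_lift i' j'"
proof -
  \<comment> \<open>Both sides depend only on residues, so finitely many cases remain; each is
    evaluated or contradicts the equivalences.\<close>
  define p q p' q' where pq: "p = i mod 3" "q = j mod 4" "p' = i' mod 3" "q' = j' mod 4"
  have ranges: "p = 0 \<or> p = 1 \<or> p = 2" "p' = 0 \<or> p' = 1 \<or> p' = 2"
    "q = 0 \<or> q = 1 \<or> q = 2 \<or> q = 3" "q' = 0 \<or> q' = 1 \<or> q' = 2 \<or> q' = 3"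
    unfolding pq by presburger+
  have "p = 0 \<longleftrightarrow> q = 0" "p' = 0 \<longleftrightarrow> q' = 0"
    using assms(1,2) by (simp_all add: pq dvd_eq_mod_eq_0)
  moreover have "(p - p') mod 3 = 0 \<longleftrightarrow> (q - q') mod 4 = 0"
    using assms(3) by (simp add: pq dvd_eq_mod_eq_0 mod_diff_eq)
  ultimately have "theta_lift (p - p') (q - q') = theta_lift p q - theta_lift p' q'"
    using ranges by (elim disjE; simp add: theta_lift_def)
  moreover have "theta_lift (p - p') (q - q') = theta_lift (i - i') (j - j')"
    "theta_lift p q = theta_lift i j" "theta_lift p' q' = theta_lift i' j'"
    by (rule theta_lift_cong; simp add: pq mod_diff_eq)+
  ultimately show ?thesis
    by simp
qed

section \<open>Small exponents and powers of an element of order at least three\<close>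

lemma theta_lift_eq_0_iff: "theta_lift i j = 0 \<longleftrightarrow> 4 dvd j"
  by (auto simp: theta_lift_def Let_def)

lemma abs_theta_lift_le: "\<bar>theta_lift i j\<bar> \<le> 2"
  by (simp add: theta_lift_def Let_def)

lemma (in group) int_pow_small_eq_one_iff:
  assumes "x \<in> carrier G" "ord x = 0 \<or> ord x \<ge> 3" "\<bar>k\<bar> \<le> 2"
  shows "x [^] k = \<one> \<longleftrightarrow> k = (0::int)"
proof -
  \<comment> \<open>Infinite order fits in as \<open>ord x = 0\<close>, since only \<open>0\<close>
    is divisible by \<open>0\<close>. A positive order is at least 3 and exceeds the size of
    \<open>k\<close>.\<close>
  have "int (ord x) dvd k \<longleftrightarrow> k = 0"
  proof
    assume "int (ord x) dvd k"
    then show "k = 0"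
      using assms(2,3) dvd_imp_le_int[of k "int (ord x)"] by (cases "k = 0") auto
  qed simp
  then show ?thesis
    using int_pow_eq_id[OF assms(1)] by simp
qed

text \<open>All factors are powers of the one element \<open>x\<close>, so exponents add even in a
  non-abelian group.\<close>

lemma walk_gain_int_pow:
  assumes "group \<Gamma>" "x \<in> carrier \<Gamma>"
  shows "walk_gain \<Gamma> (\<lambda>a. x [^]\<^bsub>\<Gamma>\<^esub> (\<kappa> a :: int)) as = x [^]\<^bsub>\<Gamma>\<^esub> sum_list (map \<kappa> as)"
  using assms by (induction as) (simp_all add: group.int_pow_mult)

lemma gainable_if_Z3_Z4_gainable:
  fixes \<Gamma> :: "'g monoid"
  assumes "finite_graph G" "group \<Gamma>" "has_element_of_order_ge_3 \<Gamma>"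
    and "gainable (integer_mod_group 3) (G, \<B>)" "gainable (integer_mod_group 4) (G, \<B>)"
  shows "gainable \<Gamma> (G, \<B>)"
proof -
  interpret incidence G
    using assms(1) by unfold_locales (auto simp: finite_graph_def)
  obtain a where a: "gaining (integer_mod_group 3) G a" "\<B> = balanced_cycles (integer_mod_group 3) G a"
    using assms(4) by (auto simp: gainable_def)
  obtain b where b: "gaining (integer_mod_group 4) G b" "\<B> = balanced_cycles (integer_mod_group 4) G b"
    using assms(5) by (auto simp: gainable_def)
  define f where "f as = theta_lift (sum_list (map a as)) (sum_list (map b as))" for as
  \<comment> \<open>Each circuit traverses a cycle, and both gainings have \<open>\<B>\<close> as
    their set of balanced cycles.\<close>
  have consistent: "3 dvd sum_list (map a as) \<longleftrightarrow> 4 dvd sum_list (map b as)" if as: "circuit G u as" for u as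
  proof -
    obtain C where "is_cycle G C" "simple_closed_walk C u as"
      by (rule circuit_imp_cycle[OF incidence_axioms as])
    then show ?thesis
      using balanced_iff_circuit_dvd[OF _ a(1)] balanced_iff_circuit_dvd[OF _ b(1)] a(2) b(2) by simp
  qed
  have sum_rev: "3 dvd sum_list (map a as) + sum_list (map a (rev_walk as))"
    "4 dvd sum_list (map b as) + sum_list (map b (rev_walk as))"
    if "set as \<subseteq> arcs G" "\<forall>c\<in>set as. src c \<noteq> tgt c" for as
    using sum_list_rev_walk[OF _ that] gaining_integer_mod_group_skew[OF a(1)]
      gaining_integer_mod_group_skew[OF b(1)] by simp_all
  have "\<exists>\<kappa>. (\<forall>e x y. x \<noteq> y \<longrightarrow> \<kappa> (e, y, x) = - \<kappa> (e, x, y)) \<and>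
      (\<forall>u as. circuit G u as \<longrightarrow> sum_list (map \<kappa> as) = f as)"
  proof (rule theta_additive_imp_potential)
    show "finite (edges G)" "incidence G"
      using assms(1) incidence_axioms by (auto simp: finite_graph_def)
    show "f (q @ p) = f (p @ q)" for p q
      by (simp add: f_def add.commute)
    fix u as
    assume as: "circuit G u as" "\<forall>c\<in>set as. src c \<noteq> tgt c"
    have "set as \<subseteq> arcs G"
      using as(1) walk_arcs[of G u as u] by (simp add: circuit_def)
    note rev = sum_rev[OF this as(2)]
    \<comment> \<open>Written as differences from \<open>0\<close>, so that
      \<open>theta_lift_diff\<close> yields the change of sign.\<close>
    have "f (rev_walk as) = theta_lift (0 - sum_list (map a as)) (0 - sum_list (map b as))"
      unfolding f_def by (rule theta_lift_cong) (use rev in \<open>simp_all add: mod_eq_dvd_iff add.commute\<close>)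
    also have "\<dots> = - f as"
      using theta_lift_diff[of 0 0 "sum_list (map a as)" "sum_list (map b as)"] consistent[OF as(1)]
      by (simp add: f_def theta_lift_eq_0_iff)
    finally show "f (rev_walk as) = - f as" .
  next
    fix u s t r p q r'
    assume *: "circuit G u (r @ p @ r')" "circuit G u (r @ q @ r')" "is_path G s q t"
      "circuit G s (p @ rev_walk q)"
    have "set q \<subseteq> arcs G" "\<forall>c\<in>set q. src c \<noteq> tgt c"
      using *(3) walk_arcs[of G s q t] path_arcs(1)[OF *(3)] by (simp_all add: is_path_def)
    note q = sum_rev[OF this]
    \<comment> \<open>\<open>r\<close> and \<open>r'\<close> cancel in the difference, and reversing
      \<open>q\<close> negates its sums modulo 3 and 4.\<close>
    have mods: "sum_list (map a (p @ rev_walk q)) mod 3 =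
        (sum_list (map a (r @ p @ r')) - sum_list (map a (r @ q @ r'))) mod 3"
      "sum_list (map b (p @ rev_walk q)) mod 4 =
        (sum_list (map b (r @ p @ r')) - sum_list (map b (r @ q @ r'))) mod 4"
      using q by (simp_all add: mod_eq_dvd_iff add.commute)
    have "theta_lift (sum_list (map a (r @ p @ r')) - sum_list (map a (r @ q @ r')))
        (sum_list (map b (r @ p @ r')) - sum_list (map b (r @ q @ r'))) =
        f (r @ p @ r') - f (r @ q @ r')"
      unfolding f_def
      by (rule theta_lift_diff)
        (use consistent[OF *(1)] consistent[OF *(2)] consistent[OF *(4)] mods in
          \<open>simp_all only: dvd_eq_mod_eq_0\<close>)
    then show "f (r @ p @ r') - f (r @ q @ r') = f (p @ rev_walk q)"
      using theta_lift_cong[OF mods] by (simp add: f_def)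
  qed
  then obtain \<kappa> where skew: "\<And>e x y. x \<noteq> y \<Longrightarrow> \<kappa> (e, y, x) = - \<kappa> (e, x, y)"
    and \<kappa>: "\<And>u as. circuit G u as \<Longrightarrow> sum_list (map \<kappa> as) = f as"
    by blast
  interpret \<Gamma>: group \<Gamma>
    by fact
  obtain x where x: "x \<in> carrier \<Gamma>" "\<Gamma>.ord x = 0 \<or> \<Gamma>.ord x \<ge> 3"
    using assms(3) by (auto simp: has_element_of_order_ge_3_def)
  define \<gamma> where "\<gamma> c = x [^]\<^bsub>\<Gamma>\<^esub> \<kappa> c" for c
  have "gaining \<Gamma> G \<gamma>"
    unfolding gaining_def \<gamma>_def using x(1) skew by (auto simp: \<Gamma>.int_pow_neg)
  moreover have "\<B> = balanced_cycles \<Gamma> G \<gamma>"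
  proof -
    \<comment> \<open>The two gains are trivial on the same simple closed walks, because
      \<open>f\<close> vanishes exactly where 4 divides the sum of \<open>b\<close>.\<close>
    have "walk_gain \<Gamma> \<gamma> as = \<one>\<^bsub>\<Gamma>\<^esub> \<longleftrightarrow> walk_gain (integer_mod_group 4) b as = \<one>\<^bsub>integer_mod_group 4\<^esub>"
      if C: "is_cycle G C" "simple_closed_walk C u as" for C u as
    proof -
      have sub: "subgraph C G"
        using C(1) by (simp add: is_cycle_def)
      then have "verts C \<subseteq> verts G"
        by (simp add: subgraph_def)
      then have "circuit G u as"
        using circuit_mono[OF simple_closed_walk_imp_circuit[OF C]] subgraph_arcs[OF sub] by simp
      then have "walk_gain \<Gamma> \<gamma> as = x [^]\<^bsub>\<Gamma>\<^esub> f as"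
        using walk_gain_int_pow[OF assms(2) x(1), of \<kappa> as] \<kappa>[of u as] by (simp add: \<gamma>_def [abs_def])
      then have "walk_gain \<Gamma> \<gamma> as = \<one>\<^bsub>\<Gamma>\<^esub> \<longleftrightarrow> 4 dvd sum_list (map b as)"
        using \<Gamma>.int_pow_small_eq_one_iff[OF x abs_theta_lift_le] by (simp add: f_def theta_lift_eq_0_iff)
      then show ?thesis
        by (simp add: walk_gain_integer_mod_group dvd_eq_mod_eq_0)
    qed
    then show ?thesis
      unfolding b(2) balanced_cycles_def by (intro Collect_cong) metis
  qed
  ultimately show ?thesis
    unfolding gainable_def by blast
qed

text \<open>The residue \<open>1\<close> is a generator; the neutral element is \<open>0\<close>.
  The power of \<open>1\<close> with exponent \<open>ord 1\<close> is that exponent modulo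
  \<open>n\<close>, so \<open>n\<close> divides \<open>ord 1\<close>.\<close>

lemma integer_mod_group_has_element_of_order_ge_3:
  assumes "n \<ge> 3"
  shows "has_element_of_order_ge_3 (integer_mod_group n)"
proof -
  interpret group "integer_mod_group n"
    by simp
  have one: "1 \<in> carrier (integer_mod_group n)"
    using assms by simp
  have "int (ord 1) mod int n = 0"
    using pow_ord_eq_1[OF one] by simp
  then have "ord 1 = 0 \<or> ord 1 \<ge> n"
    by (metis dvd_eq_mod_eq_0 dvd_imp_le int_dvd_int_iff not_gr_zero)
  then show ?thesis
    using one assms unfolding has_element_of_order_ge_3_def by (intro bexI[of _ 1]) auto
qed

theorem theorem1p7:
  fixes \<Omega> :: "('v, 'e) bgraph"
  assumes "biased_graph \<Omega>"
  shows "gainable_over_all_groups TYPE('g) \<Omega> \<longleftrightarrow>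
         gainable (integer_mod_group 3) \<Omega> \<and> gainable (integer_mod_group 4) \<Omega>"
proof
  assume "gainable_over_all_groups TYPE('g) \<Omega>"
  \<comment> \<open>Both cyclic groups have elements of type \<open>int\<close>, so the second
    conjunct of \<open>gainable_over_all_groups\<close> applies.\<close>
  then show "gainable (integer_mod_group 3) \<Omega> \<and> gainable (integer_mod_group 4) \<Omega>"
    by (simp add: gainable_over_all_groups_def integer_mod_group_has_element_of_order_ge_3)
next
  assume *: "gainable (integer_mod_group 3) \<Omega> \<and> gainable (integer_mod_group 4) \<Omega>"
  obtain G \<B> where \<Omega>: "\<Omega> = (G, \<B>)"
    by (cases \<Omega>)
  then have "finite_graph G"
    using assms by (simp add: biased_graph_def)
  \<comment> \<open>The same polymorphic lemma settles both conjuncts, at the element types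
    \<open>'g\<close> and \<open>int\<close>.\<close>
  then show "gainable_over_all_groups TYPE('g) \<Omega>"
    using * unfolding gainable_over_all_groups_def \<Omega>
    by (intro conjI allI impI; elim conjE) (rule gainable_if_Z3_Z4_gainable; assumption)+
qed

end
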